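(* Let $G$ be a finite simple graph with $n(G)\ge 3$ vertices, and let $\widehat{G}$ be the graph obtained from $G$ by adding a new vertex $w$ adjacent to every vertex of $G$, and then, for each vertex $u\in V(G)\cup\{w\}$, adding $\lceil\log_2(n(G)+1)\rceil+1$ new pendant vertices adjacent to $u$ (each such new vertex having $u$ as its only neighbor). Then $$\gamma_{Zg}(\widehat{G})=\gamma(\widehat{G})=\frac{\gamma_g(\widehat{G})+1}{2}.$$
   Context: Graphs are finite and simple; $n(G)$ is the number of vertices of $G$. $N(v)$ and $N[v]=N(v)\cup\{v\}$ denote the open and closed neighborhood of a vertex $v$. The domination number $\gamma(G)$ is the minimum cardinality of a set $S\subseteq V(G)$ with $\bigcup_{v\in S}N[v]=V(G)$. Games: two players, Dominator and Staller, alternately select vertices $v_1,v_2,\ldots$ of an isolate-free graph $G$. In the domination game the $i$-th move $v_i$ is legal if $N[v_i]\setminus\bigcup_{j=1}^{i-1}N[v_j]\neq\emptyset$. In the Z-domination game the $i$-th move $v_i$ is legal if $N(v_i)\setminus\bigcup_{j=1}^{i-1}N[v_j]\neq\emptyset$. Each game ends when no legal move is available. Dominator wants to minimize the total number of moves, Staller wants to maximize it. When Dominator moves first and both players play optimally, the total number of moves played (by both players) is $\gamma_g(G)$ for the domination game and $\gamma_{Zg}(G)$ for the Z-domination game. *)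

theory Defs
  imports Complex_Main "Graph_Theory.Pair_Digraph"
begin

text \<open>
  Finite simple graphs are the models of the locale \<open>pair_graph\<close>: finite, loop-free digraphs
  without parallel arcs whose arc relation is symmetric.
\<close>

definition open_nbhd :: "'a pair_pre_digraph \<Rightarrow> 'a \<Rightarrow> 'a set" where
  "open_nbhd G v = {u \<in> pverts G. (v, u) \<in> parcs G}"

definition closed_nbhd :: "'a pair_pre_digraph \<Rightarrow> 'a \<Rightarrow> 'a set" where
  "closed_nbhd G v = insert v (open_nbhd G v)"

definition dominated :: "'a pair_pre_digraph \<Rightarrow> 'a set \<Rightarrow> 'a set" where
  "dominated G S = (\<Union>v\<in>S. closed_nbhd G v)"

definition domination_number :: "'a pair_pre_digraph \<Rightarrow> nat" where
  "domination_number G = Min (card ` {S. S \<subseteq> pverts G \<and> dominated G S = pverts G})"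


datatype game = Domination_Game | Z_Domination_Game

fun game_nbhd :: "game \<Rightarrow> 'a pair_pre_digraph \<Rightarrow> 'a \<Rightarrow> 'a set" where
  "game_nbhd Domination_Game G v = closed_nbhd G v"
| "game_nbhd Z_Domination_Game G v = open_nbhd G v"

text \<open>
  The list \<open>vs\<close> holds the vertices selected so far by both players, latest first. Even in the
  Z-domination game the vertices already covered are those in the closed neighborhoods of \<open>vs\<close>.
\<close>
definition legal_moves :: "game \<Rightarrow> 'a pair_pre_digraph \<Rightarrow> 'a list \<Rightarrow> 'a set" where
  "legal_moves g G vs = {v \<in> pverts G. game_nbhd g G v - dominated G (set vs) \<noteq> {}}"

lemma legal_move_decreases:
  assumes "finite (pverts G)" and "v \<in> legal_moves g G vs"
  shows "card (pverts G - dominated G (set (v # vs))) < card (pverts G - dominated G (set vs))"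
proof (rule psubset_card_mono)
  from assms(2) obtain u where "u \<in> game_nbhd g G v" "u \<notin> dominated G (set vs)" "v \<in> pverts G"
    unfolding legal_moves_def by blast
  then have "u \<in> closed_nbhd G v" "u \<in> pverts G"
    by (cases g; auto simp: closed_nbhd_def open_nbhd_def)+
  with \<open>u \<notin> dominated G (set vs)\<close>
  show "pverts G - dominated G (set (v # vs)) \<subset> pverts G - dominated G (set vs)"
    by (auto simp: dominated_def)
qed (use assms(1) in simp)

datatype player = Dominator | Staller

fun opponent :: "player \<Rightarrow> player" where
  "opponent Dominator = Staller"
| "opponent Staller = Dominator"

text \<open>
  Minimax value of a position: the number of moves still to be made under optimal play after the
  moves \<open>vs\<close>, with player \<open>p\<close> to move. The finiteness test only serves to make the recursion
  terminate on arbitrary records.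
\<close>
function remaining_moves :: "game \<Rightarrow> 'a pair_pre_digraph \<Rightarrow> player \<Rightarrow> 'a list \<Rightarrow> nat" where
  "remaining_moves g G p vs =
    (if infinite (pverts G) \<or> legal_moves g G vs = {} then 0
     else 1 + (case p of Dominator \<Rightarrow> Min | Staller \<Rightarrow> Max)
                ((\<lambda>v. remaining_moves g G (opponent p) (v # vs)) ` legal_moves g G vs))"
  by auto
termination
  by (relation "measure (\<lambda>(g, G, p, vs). card (pverts G - dominated G (set vs)))")
     (auto simp del: list.set intro: legal_move_decreases)

declare remaining_moves.simps [simp del]

definition game_domination_number :: "'a pair_pre_digraph \<Rightarrow> nat" where
  "game_domination_number G = remaining_moves Domination_Game G Dominator []"

definition Z_game_domination_number :: "'a pair_pre_digraph \<Rightarrow> nat" where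
  "Z_game_domination_number G = remaining_moves Z_Domination_Game G Dominator []"


text \<open>
  \<open>Orig v\<close> is the copy of the vertex \<open>v\<close> of \<open>G\<close>, \<open>Apex\<close> is the vertex \<open>w\<close> adjacent to all of them,
  and \<open>Pendant u i\<close> is the \<open>i\<close>-th pendant vertex attached to \<open>u\<close>. Only pendants attached to
  \<open>Orig v\<close> or to \<open>Apex\<close> occur in the graph \<open>hat G\<close>.
\<close>
datatype 'a hat_vertex = Orig 'a | Apex | Pendant "'a hat_vertex" nat

definition hat_core :: "'a pair_pre_digraph \<Rightarrow> 'a hat_vertex set" where
  "hat_core G = Orig ` pverts G \<union> {Apex}"

definition num_pendants :: "'a pair_pre_digraph \<Rightarrow> nat" where
  "num_pendants G = nat \<lceil>log 2 (real (card (pverts G) + 1))\<rceil> + 1"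

definition hat_edges :: "'a pair_pre_digraph \<Rightarrow> 'a hat_vertex rel" where
  "hat_edges G =
     {(Orig u, Orig v) | u v. (u, v) \<in> parcs G} \<union>
     {(Apex, Orig v) | v. v \<in> pverts G} \<union>
     {(u, Pendant u i) | u i. u \<in> hat_core G \<and> i < num_pendants G}"

definition hat :: "'a pair_pre_digraph \<Rightarrow> 'a hat_vertex pair_pre_digraph" where
  "hat G = \<lparr> pverts = hat_core G \<union> {Pendant u i | u i. u \<in> hat_core G \<and> i < num_pendants G},
             parcs = hat_edges G \<union> (hat_edges G)\<inverse> \<rparr>"

lemma pair_graph_hat:
  assumes "pair_graph G"
  shows "pair_graph (hat G)"
proof -
  interpret pair_graph G by (fact assms)
  have C: "finite (hat_core G)"
    by (simp add: hat_core_def pair_finite_verts)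
  have "{Pendant u i | u i. u \<in> hat_core G \<and> i < num_pendants G} =
      (\<lambda>(u, i). Pendant u i) ` (hat_core G \<times> {..<num_pendants G})"
    by auto
  with C have V: "finite (pverts (hat G))"
    by (simp add: hat_def)
  have E: "hat_edges G \<subseteq> pverts (hat G) \<times> pverts (hat G)"
    by (auto simp: hat_edges_def hat_def hat_core_def dest: in_arcsD1 in_arcsD2)
  then have E': "parcs (hat G) \<subseteq> pverts (hat G) \<times> pverts (hat G)"
    by (auto simp: hat_def)
  have L: "fst e \<noteq> snd e" if "e \<in> parcs (hat G)" for e
  proof -
    have "Pendant u i \<noteq> u" for u :: "'a hat_vertex" and i
      by (metis add_Suc_right hat_vertex.size(6) lessI less_add_Suc1 less_not_refl)
    moreover have "u \<noteq> v" if "(u, v) \<in> parcs G" for u v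
      using pair_no_loops[OF that] by simp
    ultimately show ?thesis
      using that by (cases e) (auto simp: hat_def hat_edges_def)
  qed
  show ?thesis
  proof
    show "finite (parcs (hat G))"
      using E' V by (rule finite_subset[OF _ finite_cartesian_product]) fact
    show "symmetric (hat G)"
      by (auto simp: symmetric_def hat_def intro: symI)
  qed (use V E' L in auto)
qed

lemma hat_isolate_free:
  assumes "v \<in> pverts (hat G)"
  shows "open_nbhd (hat G) v \<noteq> {}"
proof -
  have "0 < num_pendants G"
    by (simp add: num_pendants_def)
  from assms consider "v \<in> hat_core G"
    | u i where "v = Pendant u i" "u \<in> hat_core G" "i < num_pendants G"
    by (auto simp: hat_def)
  then show ?thesis
  proof cases
    case 1
    with \<open>0 < num_pendants G\<close> have "Pendant v 0 \<in> open_nbhd (hat G) v"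
      by (auto simp: hat_def hat_edges_def open_nbhd_def)
    then show ?thesis by blast
  next
    case (2 u i)
    then have "u \<in> open_nbhd (hat G) v"
      by (auto simp: hat_def hat_edges_def open_nbhd_def)
    then show ?thesis by blast
  qed
qed

end

theory Submission
  imports Defs
begin

text \<open>
  Write \<open>N\<close> for the number of core vertices and \<open>k\<close> for the number of pendants at each of them.
  A dominating set contains, for every core vertex \<open>u\<close>, either \<open>u\<close> or a pendant at \<open>u\<close>, so both the
  domination number and the length of every finished Z-domination game are at least \<open>N\<close>; the core
  itself is dominating. In the Z-domination game Dominator opens with the apex; this dominates the
  whole core, so pendants are never legal afterwards and at most \<open>N - 1\<close> further moves are possible.

  In the domination game Dominator finishes by his \<open>N\<close>-th move by playing only core vertices. Staller
  reaches \<open>2 * N - 1\<close> moves by always playing a pendant at a core vertex with the largest number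
  \<open>r\<close> of undominated pendants, which keeps the sum of \<open>2 powr - r\<close> over the unused core vertices at
  most \<open>1/2\<close>: after Dominator has removed a vertex the sum is less than \<open>1/2\<close>, and being a
  multiple of its smallest summand it leaves room for doubling that summand. Initially the sum is
  \<open>N / 2 ^ k\<close>, hence the number of pendants in the construction.
\<close>

section \<open>Bounds on the minimax value of a position\<close>

lemma remaining_moves_no_legal:
  "legal_moves g G vs = {} \<Longrightarrow> remaining_moves g G p vs = 0"
  by (simp add: remaining_moves.simps)

lemma finite_legal_moves: "finite (pverts G) \<Longrightarrow> finite (legal_moves g G vs)"
  by (simp add: legal_moves_def)

lemma remaining_moves_Dominator_le:
  assumes "finite (pverts G)" "v \<in> legal_moves g G vs"
  shows "remaining_moves g G Dominator vs \<le> Suc (remaining_moves g G Staller (v # vs))"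
  using assms finite_legal_moves[OF assms(1), of g vs]
  by (subst remaining_moves.simps) (auto intro!: Min_le)

lemma remaining_moves_Staller_ge:
  assumes "finite (pverts G)" "v \<in> legal_moves g G vs"
  shows "Suc (remaining_moves g G Dominator (v # vs)) \<le> remaining_moves g G Staller vs"
  using assms finite_legal_moves[OF assms(1), of g vs]
  by (subst (2) remaining_moves.simps) (auto intro!: Max_ge)

text \<open>Both \<open>Min\<close> and \<open>Max\<close> are attained, so a bound that survives
  every legal move holds whoever is to move. The two preceding lemmas instead let the player to move
  pick one good vertex.\<close>

lemma remaining_moves_ge:
  assumes "finite (pverts G)" "legal_moves g G vs \<noteq> {}"
    and "\<And>v. v \<in> legal_moves g G vs \<Longrightarrow> b \<le> remaining_moves g G (opponent p) (v # vs)"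
  shows "Suc b \<le> remaining_moves g G p vs"
proof -
  let ?R = "(\<lambda>v. remaining_moves g G (opponent p) (v # vs)) ` legal_moves g G vs"
  have R: "finite ?R" "?R \<noteq> {}"
    using assms(1,2) finite_legal_moves[OF assms(1)] by simp_all
  have "b \<le> (case p of Dominator \<Rightarrow> Min | Staller \<Rightarrow> Max) ?R"
    using Min_in[OF R] Max_in[OF R] assms(3) by (auto split: player.split)
  with assms show ?thesis
    by (subst remaining_moves.simps) auto
qed

lemma remaining_moves_le:
  assumes "finite (pverts G)"
    and "\<And>v. v \<in> legal_moves g G vs \<Longrightarrow> remaining_moves g G (opponent p) (v # vs) \<le> b"
  shows "remaining_moves g G p vs \<le> Suc b"
proof (cases "legal_moves g G vs = {}")
  case False
  let ?R = "(\<lambda>v. remaining_moves g G (opponent p) (v # vs)) ` legal_moves g G vs"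
  have R: "finite ?R" "?R \<noteq> {}"
    using False finite_legal_moves[OF assms(1)] by simp_all
  have "(case p of Dominator \<Rightarrow> Min | Staller \<Rightarrow> Max) ?R \<le> b"
    using Min_in[OF R] Max_in[OF R] assms(2) by (auto split: player.split)
  with assms show ?thesis
    by (subst remaining_moves.simps) auto
qed (simp add: remaining_moves_no_legal)

lemma game_nbhd_subset_verts: "v \<in> pverts G \<Longrightarrow> game_nbhd g G v \<subseteq> pverts G"
  by (cases g) (auto simp: closed_nbhd_def open_nbhd_def)

lemma open_nbhd_subset_game_nbhd: "open_nbhd G v \<subseteq> game_nbhd g G v"
  by (cases g) (auto simp: closed_nbhd_def)

lemma legal_moves_empty_if_dominated:
  assumes "pverts G \<subseteq> dominated G (set vs)"
  shows "legal_moves g G vs = {}"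
  using assms game_nbhd_subset_verts[of _ G g] by (fastforce simp: legal_moves_def)

section \<open>Domination and legal moves in the graph \<open>hat G\<close>\<close>

lemma finite_hat_core: "finite (pverts G) \<Longrightarrow> finite (hat_core G)"
  by (simp add: hat_core_def)

lemma card_hat_core: "finite (pverts G) \<Longrightarrow> card (hat_core G) = card (pverts G) + 1"
proof -
  assume "finite (pverts G)"
  then have "card (Orig ` pverts G \<union> {Apex}) = card (Orig ` pverts G) + 1"
    by (subst card_Un_disjoint) auto
  also have "card (Orig ` pverts G) = card (pverts G)"
    by (rule card_image) (simp add: inj_on_def)
  finally show ?thesis
    by (simp add: hat_core_def)
qed

lemma num_pendants_pos: "0 < num_pendants G"
  by (simp add: num_pendants_def)

lemma hat_core_subset_verts: "hat_core G \<subseteq> pverts (hat G)"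
  by (auto simp: hat_def)

lemma pendant_in_verts:
  "u \<in> hat_core G \<Longrightarrow> i < num_pendants G \<Longrightarrow> Pendant u i \<in> pverts (hat G)"
  by (auto simp: hat_def)

lemma hat_verts_cases:
  assumes "x \<in> pverts (hat G)"
  obtains "x \<in> hat_core G"
  | u i where "x = Pendant u i" "u \<in> hat_core G" "i < num_pendants G"
  using assms by (auto simp: hat_def)

lemma pendant_in_open_nbhd_iff:
  "Pendant u i \<in> open_nbhd (hat G) v \<longleftrightarrow> v = u \<and> u \<in> hat_core G \<and> i < num_pendants G"
  by (auto simp: open_nbhd_def hat_def hat_edges_def hat_core_def)

lemma open_nbhd_pendant:
  assumes "u \<in> hat_core G" "i < num_pendants G"
  shows "open_nbhd (hat G) (Pendant u i) = {u}"
  using assms by (auto simp: open_nbhd_def hat_def hat_edges_def hat_core_def)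

lemma pendant_dominated_iff:
  assumes "u \<in> hat_core G" "i < num_pendants G"
  shows "Pendant u i \<in> dominated (hat G) S \<longleftrightarrow> u \<in> S \<or> Pendant u i \<in> S"
  using assms by (auto simp: dominated_def closed_nbhd_def pendant_in_open_nbhd_iff)

lemma in_dominated: "v \<in> S \<Longrightarrow> v \<in> dominated G S"
  by (auto simp: dominated_def closed_nbhd_def)

lemma core_dominates_hat:
  assumes "hat_core G \<subseteq> S"
  shows "pverts (hat G) \<subseteq> dominated (hat G) S"
proof
  fix x assume "x \<in> pverts (hat G)"
  then show "x \<in> dominated (hat G) S"
  proof (rule hat_verts_cases)
    assume "x \<in> hat_core G"
    with assms show ?thesis
      by (intro in_dominated) blast
  next
    fix u i assume "x = Pendant u i" "u \<in> hat_core G" "i < num_pendants G"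
    with assms show ?thesis
      by (simp add: pendant_dominated_iff subset_iff)
  qed
qed

text \<open>An undominated core vertex has neither been played nor had a pendant played at it, so
  its pendant with index 0 is undominated too. Progress of the game can therefore be read off the
  pendants alone.\<close>

lemma undominated_pendant_if_undominated:
  assumes "x \<in> pverts (hat G)" "x \<notin> dominated (hat G) S"
  obtains u i where "u \<in> hat_core G" "i < num_pendants G" "Pendant u i \<notin> dominated (hat G) S"
proof (rule hat_verts_cases[OF assms(1)])
  assume x: "x \<in> hat_core G"
  have "x \<notin> S"
    using assms(2) in_dominated[of x S "hat G"] by blast
  moreover have "Pendant x 0 \<notin> S"
  proof
    assume "Pendant x 0 \<in> S"
    then have "x \<in> dominated (hat G) S"
      unfolding dominated_def
      by (rule UN_I) (simp add: closed_nbhd_def open_nbhd_pendant[OF x num_pendants_pos])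
    with assms(2) show False
      by blast
  qed
  ultimately show thesis
    using that[OF x num_pendants_pos] by (simp add: pendant_dominated_iff[OF x num_pendants_pos])
next
  fix u i assume "x = Pendant u i" "u \<in> hat_core G" "i < num_pendants G"
  then show thesis
    using assms(2) by (intro that) simp_all
qed

text \<open>The pendant lies in the open neighborhood of \<open>u\<close>, so the argument serves
  both games at once.\<close>

lemma core_legal_if_pendant_undominated:
  assumes "u \<in> hat_core G" "i < num_pendants G" "Pendant u i \<notin> dominated (hat G) (set vs)"
  shows "u \<in> legal_moves g (hat G) vs"
proof -
  have "Pendant u i \<in> game_nbhd g (hat G) u"
    by (rule subsetD[OF open_nbhd_subset_game_nbhd])
      (simp add: pendant_in_open_nbhd_iff assms(1,2))
  then show ?thesis
    using assms(3) subsetD[OF hat_core_subset_verts assms(1)] by (auto simp: legal_moves_def)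
qed

text \<open>This keeps Dominator's strategy of playing only core vertices alive: an unfinished game
  has an undominated pendant, and the support of that pendant is unplayed and legal.\<close>

lemma legal_core_vertex_if_legal_move:
  assumes "legal_moves g (hat G) vs \<noteq> {}"
  obtains u where "u \<in> hat_core G" "u \<notin> set vs" "u \<in> legal_moves g (hat G) vs"
proof -
  obtain x where "x \<in> pverts (hat G)" "x \<notin> dominated (hat G) (set vs)"
    using assms legal_moves_empty_if_dominated[of "hat G" vs g] by blast
  then obtain u i where u: "u \<in> hat_core G" "i < num_pendants G"
    "Pendant u i \<notin> dominated (hat G) (set vs)"
    by (rule undominated_pendant_if_undominated)
  then have "u \<notin> set vs"
    by (simp add: pendant_dominated_iff)
  with u(1) show thesis
    using core_legal_if_pendant_undominated[OF u] by (rule that)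
qed

section \<open>Core vertices touched by a move; the domination number and lower bounds\<close>

fun anchor :: "'a hat_vertex \<Rightarrow> 'a hat_vertex" where
  "anchor (Pendant u i) = u"
| "anchor v = v"

lemma anchor_core: "u \<in> hat_core G \<Longrightarrow> anchor u = u"
  by (auto simp: hat_core_def)

lemma pendant_undominated_if_not_anchor:
  assumes "u \<in> hat_core G" "i < num_pendants G" "u \<notin> anchor ` S"
  shows "Pendant u i \<notin> dominated (hat G) S"
proof -
  have "u \<notin> S"
    using anchor_core[OF assms(1)] assms(3) by force
  moreover have "Pendant u i \<notin> S"
    using assms(3) by force
  ultimately show ?thesis
    by (simp add: pendant_dominated_iff[OF assms(1,2)])
qed

lemma domination_number_hat:
  assumes "finite (pverts G)" "finite (pverts (hat G))"
  shows "domination_number (hat G) = card (hat_core G)"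
  unfolding domination_number_def
proof (rule Min_eqI)
  let ?D = "{S. S \<subseteq> pverts (hat G) \<and> dominated (hat G) S = pverts (hat G)}"
  show "finite (card ` ?D)"
    using assms by simp
  have "dominated (hat G) (hat_core G) \<subseteq> pverts (hat G)"
    using hat_core_subset_verts[of G] by (auto simp: dominated_def closed_nbhd_def open_nbhd_def)
  then have "hat_core G \<in> ?D"
    using core_dominates_hat[of G "hat_core G"] hat_core_subset_verts[of G] by simp
  then show "card (hat_core G) \<in> card ` ?D"
    by blast
  fix m assume "m \<in> card ` ?D"
  then obtain S where S: "m = card S" "S \<subseteq> pverts (hat G)" "dominated (hat G) S = pverts (hat G)"
    by auto
  have "hat_core G \<subseteq> anchor ` S"
  proof
    fix u assume u: "u \<in> hat_core G"
    have "Pendant u 0 \<in> dominated (hat G) S"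
      using pendant_in_verts[OF u num_pendants_pos] S(3) by simp
    then show "u \<in> anchor ` S"
      using pendant_undominated_if_not_anchor[OF u num_pendants_pos] by blast
  qed
  with finite_subset[OF S(2) assms(2)] show "card (hat_core G) \<le> m"
    unfolding S(1) by (rule surj_card_le)
qed

text \<open>A move touches at most one core vertex. If it touches none in \<open>A\<close>, an
  arbitrary element is given up instead, so that inductions on \<open>card A\<close> always drop
  exactly one element.\<close>

lemma obtain_touched_vertex:
  assumes "A \<noteq> {}"
  obtains a where "a \<in> A" "\<And>u. u \<in> A - {a} \<Longrightarrow> u \<noteq> anchor v"
proof (cases "anchor v \<in> A")
  case True
  then show thesis
    using that by blast
next
  case False
  obtain a where "a \<in> A"
    using assms by blast
  then show thesis
    using False that[of a] by blast
qed

text \<open>While some core vertex is untouched its pendants are undominated, so the game goes on,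
  and every move touches at most one more. This is independent of the strategies, hence valid for
  both games and either player to move.\<close>

lemma remaining_moves_ge_card_untouched:
  assumes "finite (pverts (hat G))" "A \<subseteq> hat_core G - anchor ` set vs" "finite A"
  shows "card A \<le> remaining_moves g (hat G) p vs"
  using assms(2,3)
proof (induction "card A" arbitrary: A p vs)
  case (Suc n)
  have "A \<noteq> {}"
    using Suc.hyps(2) by auto
  then obtain u where "u \<in> A"
    by blast
  then have u: "u \<in> hat_core G" "u \<notin> anchor ` set vs"
    using Suc.prems(1) by auto
  have "u \<in> legal_moves g (hat G) vs"
    using pendant_undominated_if_not_anchor[OF u(1) num_pendants_pos u(2)]
    by (rule core_legal_if_pendant_undominated[OF u(1) num_pendants_pos])
  moreover have "n \<le> remaining_moves g (hat G) (opponent p) (v # vs)" for v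
  proof -
    obtain a where a: "a \<in> A" "\<And>u. u \<in> A - {a} \<Longrightarrow> u \<noteq> anchor v"
      using obtain_touched_vertex[OF \<open>A \<noteq> {}\<close>, of v] by blast
    have "n = card (A - {a})"
      using Suc.hyps(2) a(1) Suc.prems(2) by simp
    moreover have "A - {a} \<subseteq> hat_core G - anchor ` set (v # vs)"
      using Suc.prems(1) a(2) by auto
    ultimately show ?thesis
      using Suc.hyps(1) Suc.prems(2) by (metis finite_Diff)
  qed
  ultimately show ?case
    using remaining_moves_ge[OF assms(1), of g vs n p] Suc.hyps(2) by force
qed simp

section \<open>The Z-domination game\<close>

lemma Z_legal_after_apex:
  assumes "finite (pverts G)" "Apex \<in> set vs" "v \<in> legal_moves Z_Domination_Game (hat G) vs"
  shows "v \<in> hat_core G - set vs"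
proof -
  have "hat_core G \<subseteq> closed_nbhd (hat G) Apex"
    by (auto simp: closed_nbhd_def open_nbhd_def hat_def hat_edges_def hat_core_def)
  then have dom: "hat_core G \<subseteq> dominated (hat G) (set vs)"
    using assms(2) by (auto simp: dominated_def)
  have v: "v \<in> pverts (hat G)" "\<not> open_nbhd (hat G) v \<subseteq> dominated (hat G) (set vs)"
    using assms(3) by (auto simp: legal_moves_def)
  then have "v \<notin> set vs"
    by (auto simp: dominated_def closed_nbhd_def)
  moreover from v(1) have "v \<in> hat_core G"
  proof (rule hat_verts_cases)
    fix u i assume "v = Pendant u i" "u \<in> hat_core G" "i < num_pendants G"
    \<comment> \<open>A pendant's only neighbor is its support, already dominated by the apex, so
      playing the pendant would be illegal.\<close>
    then show "v \<in> hat_core G"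
      using v(2) dom open_nbhd_pendant[of u G i] by auto
  qed
  ultimately show ?thesis
    by blast
qed

lemma Z_remaining_moves_after_apex_le:
  assumes "finite (pverts (hat G))" "finite (pverts G)" "Apex \<in> set vs"
  shows "remaining_moves Z_Domination_Game (hat G) p vs \<le> card (hat_core G - set vs)"
  using assms(3)
proof (induction "card (hat_core G - set vs)" arbitrary: p vs)
  case 0
  then have "legal_moves Z_Domination_Game (hat G) vs = {}"
    using Z_legal_after_apex[OF assms(2)] finite_hat_core[OF assms(2)] by force
  then show ?case
    by (simp add: remaining_moves_no_legal)
next
  case (Suc n)
  have "remaining_moves Z_Domination_Game (hat G) (opponent p) (v # vs) \<le> n"
    if "v \<in> legal_moves Z_Domination_Game (hat G) vs" for v
  proof -
    have "hat_core G - set (v # vs) = (hat_core G - set vs) - {v}"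
      by auto
    then have "n = card (hat_core G - set (v # vs))"
      using Z_legal_after_apex[OF assms(2) Suc.prems that] Suc.hyps(2) by simp
    then show ?thesis
      using Suc.hyps(1)[of "v # vs" "opponent p"] Suc.prems by simp
  qed
  then show ?case
    using remaining_moves_le[OF assms(1)] Suc.hyps(2) by metis
qed

lemma Z_game_domination_number_hat:
  assumes "finite (pverts G)" "finite (pverts (hat G))"
  shows "Z_game_domination_number (hat G) = card (hat_core G)"
proof (rule antisym)
  have apex: "Apex \<in> hat_core G"
    by (simp add: hat_core_def)
  then have "Apex \<in> legal_moves Z_Domination_Game (hat G) []"
    using core_legal_if_pendant_undominated[OF apex num_pendants_pos, of "[]"]
    by (simp add: dominated_def)
  then have "Z_game_domination_number (hat G)
      \<le> Suc (remaining_moves Z_Domination_Game (hat G) Staller [Apex])"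
    unfolding Z_game_domination_number_def using assms(2) by (rule remaining_moves_Dominator_le[rotated])
  also have "\<dots> \<le> Suc (card (hat_core G - set [Apex]))"
    using Z_remaining_moves_after_apex_le[OF assms(2,1), of "[Apex]"] by simp
  also have "\<dots> = card (hat_core G)"
    using card.remove[OF finite_hat_core[OF assms(1)] apex] by simp
  finally show "Z_game_domination_number (hat G) \<le> card (hat_core G)" .
  show "card (hat_core G) \<le> Z_game_domination_number (hat G)"
    unfolding Z_game_domination_number_def
    by (rule remaining_moves_ge_card_untouched) (use assms finite_hat_core in auto)
qed

section \<open>The domination game: Dominator's strategy\<close>

lemma remaining_moves_Dominator_le_core:
  assumes "finite (pverts (hat G))" "finite (pverts G)"
  shows "remaining_moves g (hat G) Dominator vs \<le> 2 * card (hat_core G - set vs) - 1"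
proof (induction "card (hat_core G - set vs)" arbitrary: vs rule: less_induct)
  case less
  let ?U = "\<lambda>vs. hat_core G - set vs"
  have fin: "finite (?U vs)" for vs
    using finite_hat_core[OF assms(2)] by simp
  show ?case
  proof (cases "legal_moves g (hat G) vs = {}")
    case False
    then obtain u where u: "u \<in> ?U vs" "u \<in> legal_moves g (hat G) vs"
      using legal_core_vertex_if_legal_move[OF False] by blast
    have "?U (u # vs) = ?U vs - {u}"
      by auto
    then have card_u: "card (?U vs) = Suc (card (?U (u # vs)))"
      using card.remove[OF fin u(1)] by simp
    \<comment> \<open>Staller's reply \<open>v\<close> may leave the set of unplayed core vertices
      as it is; the decrease in each round comes from Dominator's \<open>u\<close>.\<close>
    have "remaining_moves g (hat G) Staller (u # vs) \<le> 2 * card (?U (u # vs))"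
    proof (cases "legal_moves g (hat G) (u # vs) = {}")
      case False
      then have "?U (u # vs) \<noteq> {}"
        using legal_core_vertex_if_legal_move[OF False] by blast
      \<comment> \<open>Positivity is what makes \<open>Suc (2 * c - 1)\<close> equal to
        \<open>2 * c\<close> under truncated subtraction.\<close>
      then have pos: "0 < card (?U (u # vs))"
        using fin by (simp add: card_gt_0_iff)
      have "remaining_moves g (hat G) Dominator (v # u # vs) \<le> 2 * card (?U (u # vs)) - 1" for v
      proof -
        have "card (?U (v # u # vs)) \<le> card (?U (u # vs))"
          by (rule card_mono) (use fin in auto)
        then show ?thesis
          using less[of "v # u # vs"] card_u by linarith
      qed
      then have "remaining_moves g (hat G) Staller (u # vs) \<le> Suc (2 * card (?U (u # vs)) - 1)"
        by (intro remaining_moves_le[OF assms(1)]) simp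
      with pos show ?thesis
        by simp
    qed (simp add: remaining_moves_no_legal)
    then show ?thesis
      using remaining_moves_Dominator_le[OF assms(1) u(2)] card_u by simp
  qed (simp add: remaining_moves_no_legal)
qed

section \<open>The domination game: Staller's strategy\<close>

definition undominated_pendants :: "'a pair_pre_digraph \<Rightarrow> 'a hat_vertex list \<Rightarrow> 'a hat_vertex \<Rightarrow> nat set"
  where "undominated_pendants G vs u =
    {i. i < num_pendants G \<and> Pendant u i \<notin> dominated (hat G) (set vs)}"

lemma finite_undominated_pendants: "finite (undominated_pendants G vs u)"
  by (simp add: undominated_pendants_def)

lemma undominated_pendants_Cons_other:
  assumes "u \<in> hat_core G" "u \<noteq> anchor v"
  shows "undominated_pendants G (v # vs) u = undominated_pendants G vs u"
proof -
  have "v \<noteq> u" "\<And>i. Pendant u i \<noteq> v"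
    using assms anchor_core[OF assms(1)] by auto
  then show ?thesis
    by (simp add: undominated_pendants_def pendant_dominated_iff[OF assms(1)] cong: conj_cong)
qed

lemma undominated_pendants_Cons_pendant:
  assumes "u \<in> hat_core G"
  shows "undominated_pendants G (Pendant u i # vs) u = undominated_pendants G vs u - {i}"
proof -
  have "u \<noteq> Pendant u i"
    using assms by (auto simp: hat_core_def)
  then show ?thesis
    using pendant_dominated_iff[OF assms] by (auto simp: undominated_pendants_def)
qed

text \<open>The exponent \<open>r w\<close> is positive, since otherwise a summand would be 1.
  Multiplying by \<open>2 ^ r w\<close> then turns the sum and the bound 1/2 into integers, and a
  strict inequality between integers leaves a gap of at least 1, which scales back to
  \<open>(1/2) ^ r w\<close>.\<close>

lemma sum_half_powers_slack:
  fixes r :: "'b \<Rightarrow> nat"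
  assumes "finite A" "w \<in> A" "\<And>u. u \<in> A \<Longrightarrow> r u \<le> r w" "(\<Sum>u\<in>A. (1/2::real) ^ r u) < 1/2"
  shows "0 < r w" "(\<Sum>u\<in>A. (1/2::real) ^ r u) + (1/2) ^ r w \<le> 1/2"
proof -
  have "(1/2::real) ^ r w \<le> (\<Sum>u\<in>A. (1/2::real) ^ r u)"
    using assms(1,2) by (intro member_le_sum) auto
  with assms(4) show pos: "0 < r w"
    by (cases "r w") auto
  have half: "(2::real) ^ r w * (1/2) = real (2 ^ (r w - 1))"
    using pos by (cases "r w") auto
  have "(2::real) ^ r w * (1/2) ^ r u = real (2 ^ (r w - r u))" if "u \<in> A" for u
    using power_add[of "2::real" "r w - r u" "r u"] assms(3)[OF that] by (simp add: power_one_over)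
  then have scaled: "2 ^ r w * (\<Sum>u\<in>A. (1/2::real) ^ r u) = real (\<Sum>u\<in>A. 2 ^ (r w - r u))"
    by (simp add: sum_distrib_left)
  have "(2::real) ^ r w * (\<Sum>u\<in>A. (1/2::real) ^ r u) < 2 ^ r w * (1/2)"
    using assms(4) by (intro mult_strict_left_mono) auto
  then have "(\<Sum>u\<in>A. 2 ^ (r w - r u)) < (2::nat) ^ (r w - 1)"
    unfolding scaled half by (simp only: of_nat_less_iff)
  then have "real ((\<Sum>u\<in>A. 2 ^ (r w - r u)) + 1) \<le> real (2 ^ (r w - 1))"
    by (simp only: of_nat_le_iff)
  then have "2 ^ r w * ((\<Sum>u\<in>A. (1/2::real) ^ r u) + (1/2) ^ r w) \<le> 2 ^ r w * (1/2)"
    unfolding distrib_left scaled half by (simp add: power_one_over)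
  then show "(\<Sum>u\<in>A. (1/2::real) ^ r u) + (1/2) ^ r w \<le> 1/2"
    by (rule mult_left_le_imp_le) simp
qed

text \<open>The set \<open>A\<close> holds the core vertices from which Staller still expects two
  moves each, except for the last one. The bound 1/2 is the invariant at Dominator's turns; it also
  excludes played core vertices from \<open>A\<close>, as they have no undominated pendants and
  would contribute 1.\<close>

lemma remaining_moves_Dominator_ge_balanced:
  assumes "finite (pverts (hat G))" "A \<subseteq> hat_core G" "finite A"
    and "(\<Sum>u\<in>A. (1/2::real) ^ card (undominated_pendants G vs u)) \<le> 1/2"
  shows "2 * card A - 1 \<le> remaining_moves Domination_Game (hat G) Dominator vs"
  using assms(2-4)
proof (induction "card A" arbitrary: A vs)
  case (Suc n)
  let ?r = "\<lambda>vs u. card (undominated_pendants G vs u)"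
  let ?legal = "legal_moves Domination_Game (hat G)"
  have "A \<noteq> {}"
    using Suc.hyps(2) by auto
  then obtain b where b: "b \<in> A"
    by blast
  \<comment> \<open>A summand of at most 1/2 means a positive exponent, so \<open>b\<close> still
    has an undominated pendant and a legal move exists.\<close>
  have "(1/2::real) ^ ?r vs b \<le> (\<Sum>u\<in>A. (1/2) ^ ?r vs u)"
    using b Suc.prems(2) by (intro member_le_sum) auto
  also note Suc.prems(3)
  finally have "?r vs b \<noteq> 0"
    by (cases "?r vs b") auto
  then have "undominated_pendants G vs b \<noteq> {}"
    by auto
  then obtain i where "i < num_pendants G" "Pendant b i \<notin> dominated (hat G) (set vs)"
    by (auto simp: undominated_pendants_def)
  moreover have "b \<in> hat_core G"
    using b Suc.prems(1) by blast
  ultimately have "b \<in> ?legal vs"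
    using core_legal_if_pendant_undominated by blast
  moreover have "2 * n \<le> remaining_moves Domination_Game (hat G) Staller (v # vs)" for v
  proof -
    obtain a where a: "a \<in> A" "\<And>u. u \<in> A - {a} \<Longrightarrow> u \<noteq> anchor v"
      using obtain_touched_vertex[OF \<open>A \<noteq> {}\<close>, of v] by blast
    define B where "B = A - {a}"
    have B: "finite B" "B \<subseteq> hat_core G" "card B = n"
      using Suc.prems(1,2) Suc.hyps(2) a(1) by (auto simp: B_def)
    \<comment> \<open>Dominator's move leaves the summands over \<open>B\<close> unchanged, and
      dropping the positive summand of \<open>a\<close> makes the inequality strict.\<close>
    have "(\<Sum>u\<in>B. (1/2::real) ^ ?r (v # vs) u) = (\<Sum>u\<in>B. (1/2) ^ ?r vs u)"
      using B(2) a(2) by (intro sum.cong) (auto simp: B_def undominated_pendants_Cons_other)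
    also have "\<dots> < (\<Sum>u\<in>A. (1/2) ^ ?r vs u)"
      using sum.remove[OF Suc.prems(2) a(1), of "\<lambda>u. (1/2::real) ^ ?r vs u"] by (simp add: B_def)
    finally have less_half: "(\<Sum>u\<in>B. (1/2::real) ^ ?r (v # vs) u) < 1/2"
      using Suc.prems(3) by simp
    show ?thesis
    proof (cases "B = {}")
      case False
      define R where "R = ?r (v # vs) ` B"
      have "Max R \<in> R"
        using False B(1) by (auto simp: R_def intro: Max_in)
      then obtain w where w: "w \<in> B" "?r (v # vs) w = Max R"
        by (auto simp: R_def)
      have "?r (v # vs) u \<le> ?r (v # vs) w" if "u \<in> B" for u
        unfolding w(2) using that B(1) by (auto simp: R_def)
      note slack = sum_half_powers_slack[of B w "?r (v # vs)", OF B(1) w(1) this less_half]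
      from slack(1) obtain i where i: "i \<in> undominated_pendants G (v # vs) w"
        by (auto simp: card_gt_0_iff)
      let ?p = "Pendant w i"
      have wc: "w \<in> hat_core G"
        using w(1) B(2) by blast
      have p: "?p \<in> ?legal (v # vs)"
        using i pendant_in_verts[OF wc]
        by (auto simp: legal_moves_def undominated_pendants_def closed_nbhd_def)
      \<comment> \<open>Staller's pendant lowers the exponent at \<open>w\<close> by one. This
        doubles its summand, and the increase is exactly the slack available.\<close>
      have "?r (?p # v # vs) w = ?r (v # vs) w - 1"
        using i by (simp add: undominated_pendants_Cons_pendant[OF wc] finite_undominated_pendants)
      then have new: "(1/2::real) ^ ?r (?p # v # vs) w = 2 * (1/2) ^ ?r (v # vs) w"
        using slack(1) by (cases "?r (v # vs) w") auto
      have "?r (?p # v # vs) u = ?r (v # vs) u" if "u \<in> B - {w}" for u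
        using that B(2) by (subst undominated_pendants_Cons_other) auto
      then have "(\<Sum>u\<in>B. (1/2::real) ^ ?r (?p # v # vs) u)
          = (\<Sum>u\<in>B. (1/2) ^ ?r (v # vs) u) + (1/2) ^ ?r (v # vs) w"
        using new by (simp add: sum.remove[OF B(1) w(1)])
      then have "2 * card B - 1 \<le> remaining_moves Domination_Game (hat G) Dominator (?p # v # vs)"
        using Suc.hyps(1)[of B "?p # v # vs"] B slack(2) by simp
      moreover have "0 < card B"
        using False B(1) by (simp add: card_gt_0_iff)
      ultimately show ?thesis
        using remaining_moves_Staller_ge[OF assms(1) p] B(3) by linarith
    qed (use B in simp)
  qed
  ultimately have "Suc (2 * n) \<le> remaining_moves Domination_Game (hat G) Dominator vs"
    by (intro remaining_moves_ge[OF assms(1)]) auto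
  then show ?case
    using Suc.hyps(2) by linarith
qed simp

text \<open>This is the invariant 1/2 at the start of the game: the ceiling of the logarithm pays
  for the number of core vertices, and the additional pendant for the factor 2.\<close>

lemma card_hat_core_le:
  assumes "finite (pverts G)"
  shows "2 * card (hat_core G) \<le> 2 ^ num_pendants G"
proof -
  let ?N = "real (card (pverts G) + 1)" and ?m = "nat \<lceil>log 2 (real (card (pverts G) + 1))\<rceil>"
  have "?N = 2 powr log 2 ?N"
    by simp
  also have "\<dots> \<le> 2 powr real ?m"
    by (intro powr_mono real_nat_ceiling_ge) auto
  also have "\<dots> = real (2 ^ ?m)"
    by (simp only: powr_realpow zero_less_numeral of_nat_power of_nat_numeral)
  finally have "card (pverts G) + 1 \<le> 2 ^ ?m"
    by (simp only: of_nat_le_iff)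
  then show ?thesis
    using card_hat_core[OF assms] by (simp add: num_pendants_def)
qed

lemma game_domination_number_hat:
  assumes "finite (pverts G)" "finite (pverts (hat G))"
  shows "game_domination_number (hat G) = 2 * card (hat_core G) - 1"
proof (rule antisym)
  show "game_domination_number (hat G) \<le> 2 * card (hat_core G) - 1"
    using remaining_moves_Dominator_le_core[OF assms(2,1), of _ "[]"]
    by (simp add: game_domination_number_def)
  have "undominated_pendants G [] u = {..<num_pendants G}" for u
    by (auto simp: undominated_pendants_def dominated_def)
  then have "(\<Sum>u\<in>hat_core G. (1/2::real) ^ card (undominated_pendants G [] u))
      = real (card (hat_core G)) / 2 ^ num_pendants G"
    by (simp add: power_one_over)
  also have "\<dots> \<le> 1/2"
    using of_nat_mono[OF card_hat_core_le[OF assms(1)], where 'a = real] by (simp add: field_simps)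
  finally show "2 * card (hat_core G) - 1 \<le> game_domination_number (hat G)"
    unfolding game_domination_number_def
    by (intro remaining_moves_Dominator_ge_balanced[OF assms(2) order_refl finite_hat_core[OF assms(1)]])
qed

theorem proposition6p1:
  fixes G :: "'a pair_pre_digraph"
  assumes "pair_graph G" and "card (pverts G) \<ge> 3"
  shows "Z_game_domination_number (hat G) = domination_number (hat G) \<and>
         real (domination_number (hat G)) = (real (game_domination_number (hat G)) + 1) / 2"
proof -
  interpret G: pair_graph G
    by (fact assms(1))
  interpret H: pair_graph "hat G"
    using assms(1) by (rule pair_graph_hat)
  note fin = G.pair_finite_verts H.pair_finite_verts
  \<comment> \<open>Needed to read the truncated \<open>2 * card (hat_core G) - 1\<close> as a
    difference of reals.\<close>
  have "1 \<le> card (hat_core G)"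
    using card_hat_core[OF fin(1)] by simp
  then show ?thesis
    using Z_game_domination_number_hat[OF fin] domination_number_hat[OF fin]
      game_domination_number_hat[OF fin] by (simp add: of_nat_diff)
qed

end
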